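(* Let $X$ be a set, $F(X)$ the free group with basis $X$, and let TestQP and FactorQP be the procedures described in the context. (1) For every input word $w$ over the alphabet $X\cup X^{-1}$, the algorithm TestQP correctly determines whether or not $w$ is quasi-positive: TestQP$(w)$ returns true if $w$ represents a quasi-positive element of $F(X)$, and returns false otherwise. (2) Suppose that $w$ is quasi-positive, and let $T$ be the labelled rooted binary tree, encoding the good pairs of inverse letters and the corresponding subwords, that is returned by the modification of TestQP$(w)$ described in the context. Then FactorQP$(T)$ returns a factorization of $w$ in $F(X)$ as a product of conjugates of positive letters, i.e. an expression $w = x_1^{c_1}\cdots x_k^{c_k}$ with $k\ge 0$, $x_j\in X$ and $c_j\in F(X)$.
   Context: Conventions. $F(X)$ is the free group with basis $X$; a word over $X$ is a finite sequence of letters from $X\cup X^{-1}$ (not necessarily reduced), and represents an element of $F(X)$. Letters in $X$ are called positive and letters in $X^{-1}$ negative. A positive word is a nonempty word all of whose letters lie in $X$. Conjugation is $a^b=b^{-1}ab$. An element of $F(X)$ is quasi-positive if it equals $w_1^{c_1}\cdots w_k^{c_k}$ with each $w_i$ a positive word and $c_i\in F(X)$; by convention the identity element is also quasi-positive. A word is called quasi-positive if the element it represents is. TestQP$(w)$, for a word $w=y_1\cdots y_n$ with $y_i\in X\cup X^{-1}$: If no letter of $w$ is negative (in particular if $w$ is empty), return true. Otherwise let $i$ be the smallest index with $y_i\in X^{-1}$, and let $d=d_1\cdots d_{2n}=ww$ be the concatenation of $w$ with itself. For $j=1,2,\dots,n-1$ in turn: if $d_{i+j}=y_i^{-1}$,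 set $w_L=d_{i+1}\cdots d_{i+j-1}$ and $w_R=d_{i+j+1}\cdots d_{n+i-1}$ (either may be empty), and call TestQP$(w_L)$ and TestQP$(w_R)$ recursively; if both return true, then return true (the pair $y_i,d_{i+j}$ is then called a good pair of inverse letters); otherwise continue with the next $j$. If the loop over $j$ ends without returning true, return false. The modification returning a tree: when TestQP$(w)$ returns true, it also returns a labelled rooted binary tree $T$. If $w$ is empty or positive, $T$ is a single vertex containing $w$. Otherwise, if $x^{-1},x$ (with $x\in X$) is the good pair found in $w$, with corresponding subwords $w_L,w_R$, the root of $T$ contains the word $w$ and the positive letter $x$, its left child is the root of the tree returned for $w_L$, and its right child is the root of the tree returned for $w_R$. (So $w$ is a cyclic permutation of the word $x^{-1}w_Lxw_R$.) FactorQP$(T)$: number the vertices of $T$ by $1,2,\dots$ in breadth-first order. Each leaf word is regarded as a (possibly empty) product of positive letters. Repeatedly take the two remaining vertices with the largest numbers; they are the two children of a common parent and contain words $w_L$, $w_R$ already expressed as products of conjugates of positive letters. Let $w$ and $x$ be the word and the positive letter contained in the parent. Write $w=v^{-1}\bar w v$ in $F(X)$, where $\bar w$ is the cyclic reduction of $w$ and $2|v|+|\bar w|=|w|$ (with $|\cdot|$ the reduced length), and, using that $w$ and $x^{-1}w_Lxw_R$ agree up to cyclic permutation of letters, find $u\in F(X)$ with $\bar w=(w_L^{x}w_R)^{u}$ in $F(X)$. Overwrite the contents of the parent with the factorization $w_L^{xuv}\cdot w_R^{uv}$, where the exponents are distributed over the given factorizations of $w_L$ and $w_R$ using $(pq)^c=p^cq^c$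 and $(p^c)^d=p^{cd}$, and delete the two children. When only the root remains, return the factorization it contains. *)

theory Defs
  imports "HOL-Algebra.Group"
begin

section \<open>Words and the free group\<close>

datatype 'a letter = Pos 'a | Neg 'a

type_synonym 'a word = "'a letter list"

primrec inv_letter :: "'a letter \<Rightarrow> 'a letter" where
  "inv_letter (Pos x) = Neg x"
| "inv_letter (Neg x) = Pos x"

primrec base :: "'a letter \<Rightarrow> 'a" where
  "base (Pos x) = x"
| "base (Neg x) = x"

primrec negative :: "'a letter \<Rightarrow> bool" where
  "negative (Pos x) = False"
| "negative (Neg x) = True"

definition words :: "'a set \<Rightarrow> 'a word set" where
  "words X = lists (Pos ` X \<union> Neg ` X)"

definition positive_words :: "'a set \<Rightarrow> 'a word set" where
  "positive_words X = lists (Pos ` X) - {[]}"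

definition reduced :: "'a word \<Rightarrow> bool" where
  "reduced w \<longleftrightarrow> successively (\<lambda>y z. z \<noteq> inv_letter y) w"

definition push :: "'a letter \<Rightarrow> 'a word \<Rightarrow> 'a word" where
  "push y w = (case w of [] \<Rightarrow> [y] | z # zs \<Rightarrow> if z = inv_letter y then zs else y # w)"

definition reduce :: "'a word \<Rightarrow> 'a word" where
  "reduce w = foldr push w []"

text \<open>The elements of the free group are the reduced words; an arbitrary word \<open>w\<close> represents the
  element \<open>reduce w\<close>.\<close>

definition free_group :: "'a set \<Rightarrow> 'a word monoid" where
  "free_group X =
     \<lparr>carrier = {w \<in> words X. reduced w}, mult = (\<lambda>u v. reduce (u @ v)), one = []\<rparr>"

lemma inv_letter_inv_letter [simp]: "inv_letter (inv_letter y) = y"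
  by (cases y) auto

lemma inv_letter_in [simp]: "inv_letter y \<in> Pos ` X \<union> Neg ` X \<longleftrightarrow> y \<in> Pos ` X \<union> Neg ` X"
  by (cases y) auto

lemma reduced_push: "reduced w \<Longrightarrow> reduced (push y w)"
  by (cases w; cases "tl w") (auto simp: push_def reduced_def)

lemma push_push_inv: "reduced w \<Longrightarrow> push y (push (inv_letter y) w) = w"
  by (cases w; cases "tl w") (auto simp: push_def reduced_def)

lemma reduced_reduce [simp]: "reduced (reduce w)"
  unfolding reduce_def by (induction w) (auto simp: reduced_push, simp add: reduced_def)

lemma reduce_reduced [simp]: "reduced w \<Longrightarrow> reduce w = w"
  unfolding reduce_def
proof (induction w)
  case (Cons y w)
  then show ?case by (cases w) (auto simp: push_def reduced_def)
qed simp

lemma reduce_append: "reduce (u @ v) = foldr push u (reduce v)"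
  by (simp add: reduce_def)

lemma reduce_append_right [simp]: "reduce (u @ reduce v) = reduce (u @ v)"
  by (simp add: reduce_append)

lemma reduced_foldr_push: "reduced z \<Longrightarrow> reduced (foldr push u z)"
  by (induction u) (auto simp: reduced_push)

lemma foldr_push_push:
  assumes "reduced z"
  shows "foldr push (push y u) z = push y (foldr push u z)"
proof (cases u)
  case (Cons a as)
  then show ?thesis
    using push_push_inv[OF reduced_foldr_push[OF assms], of y as]
    by (auto simp: push_def[of y "a # as"])
qed (simp add: push_def)

lemma foldr_push_reduce: "reduced z \<Longrightarrow> foldr push (reduce u) z = foldr push u z"
  by (induction u) (auto simp: reduce_def foldr_push_push)

lemma reduce_append_left [simp]: "reduce (reduce u @ v) = reduce (u @ v)"
  by (simp add: reduce_append foldr_push_reduce)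

lemma words_append [simp]: "u @ v \<in> words X \<longleftrightarrow> u \<in> words X \<and> v \<in> words X"
  by (auto simp: words_def)

lemma push_words: "y \<in> Pos ` X \<union> Neg ` X \<Longrightarrow> w \<in> words X \<Longrightarrow> push y w \<in> words X"
  by (auto simp: push_def words_def split: list.splits)

lemma reduce_words: "w \<in> words X \<Longrightarrow> reduce w \<in> words X"
  unfolding reduce_def
proof (induction w)
  case (Cons y w)
  then show ?case using push_words[of y X] by (auto simp: words_def)
qed simp

lemma reduce_in_free_group: "w \<in> words X \<Longrightarrow> reduce w \<in> carrier (free_group X)"
  by (simp add: free_group_def reduce_words)

definition inv_word :: "'a word \<Rightarrow> 'a word" where
  "inv_word w = rev (map inv_letter w)"

lemma inv_word_words: "w \<in> words X \<Longrightarrow> inv_word w \<in> words X"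
  unfolding words_def inv_word_def in_lists_conv_set set_rev set_map
  by (metis imageE inv_letter_in)

lemma reduce_inv_word: "reduce (inv_word w @ w) = []"
proof -
  have "foldr push (inv_word w) (foldr push w z) = z" if "reduced z" for z :: "'a word"
  proof (induction w)
    case (Cons y w)
    then show ?case
      using push_push_inv[of "foldr push w z" "inv_letter y"] reduced_foldr_push[OF that, of w]
      by (simp add: inv_word_def)
  qed (simp add: inv_word_def)
  from this[of "[]"] show ?thesis by (simp add: reduce_def reduced_def)
qed

lemma group_free_group: "group (free_group X)"
proof (rule groupI)
  fix x assume "x \<in> carrier (free_group X)"
  then show "\<exists>y\<in>carrier (free_group X). y \<otimes>\<^bsub>free_group X\<^esub> x = \<one>\<^bsub>free_group X\<^esub>"
    by (intro bexI[of _ "reduce (inv_word x)"])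
      (auto simp: free_group_def reduce_inv_word reduce_words inv_word_words)
qed (auto simp: free_group_def reduce_words, auto simp: words_def reduced_def)

lemma inv_free_group:
  assumes "w \<in> carrier (free_group X)"
  shows "inv\<^bsub>free_group X\<^esub> w = reduce (inv_word w)"
  using assms
  by (intro group.inv_equality[OF group_free_group])
    (auto simp: free_group_def reduce_inv_word reduce_words inv_word_words)

lemma reduce_append_eq_mult:
  "reduce (u @ v) = reduce u \<otimes>\<^bsub>free_group X\<^esub> reduce v"
  by (simp add: free_group_def)

lemma free_group_extend_hom:
  assumes H: "group H" and f: "f \<in> X \<rightarrow> carrier H"
  shows "\<exists>h\<in>hom (free_group X) H. \<forall>x\<in>X. h [Pos x] = f x"
proof -
  interpret group H by fact
  define e where "e y = (case y of Pos x \<Rightarrow> f x | Neg x \<Rightarrow> inv\<^bsub>H\<^esub> f x)" for y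
  define h where "h w = foldr (\<lambda>y g. e y \<otimes>\<^bsub>H\<^esub> g) w \<one>\<^bsub>H\<^esub>" for w
  have e: "e y \<in> carrier H" if "y \<in> Pos ` X \<union> Neg ` X" for y
    using that f by (auto simp: e_def Pi_iff)
  have h: "h w \<in> carrier H" if "w \<in> words X" for w
    using that by (induction w) (auto simp: h_def words_def intro!: m_closed e)
  have h_append: "h (u @ v) = h u \<otimes>\<^bsub>H\<^esub> h v" if "u \<in> words X" "v \<in> words X" for u v
    using that
  proof (induction u)
    case Nil
    then show ?case using h[OF Nil(2)] by (simp add: h_def)
  next
    case (Cons y u)
    then have "u \<in> words X" "y \<in> Pos ` X \<union> Neg ` X" by (auto simp: words_def)
    then show ?case
      using Cons h[of u] h[of v] e[of y] by (simp add: h_def m_assoc)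
  qed
  have e_inv: "e y \<otimes>\<^bsub>H\<^esub> e (inv_letter y) = \<one>\<^bsub>H\<^esub>" if "y \<in> Pos ` X \<union> Neg ` X" for y
    using that f by (auto simp: e_def Pi_iff)
  have h_push: "h (push y w) = e y \<otimes>\<^bsub>H\<^esub> h w" if y: "y \<in> Pos ` X \<union> Neg ` X" and w: "w \<in> words X" for y w
  proof (cases "\<exists>zs. w = inv_letter y # zs")
    case True
    then obtain zs where zs: "w = inv_letter y # zs" by blast
    have mem: "zs \<in> words X" "inv_letter y \<in> Pos ` X \<union> Neg ` X"
      using w y unfolding zs by (auto simp: words_def simp del: inv_letter_in)
    have "e y \<otimes>\<^bsub>H\<^esub> (e (inv_letter y) \<otimes>\<^bsub>H\<^esub> h zs) = h zs"
      using e_inv[OF y] e[OF y] e[OF mem(2)] h[OF mem(1)] by (simp flip: m_assoc)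
    then show ?thesis by (simp add: zs push_def h_def)
  next
    case False
    then show ?thesis by (auto simp: push_def h_def split: list.splits)
  qed
  have h_reduce: "h (reduce w) = h w" if "w \<in> words X" for w
    using that
  proof (induction w)
    case (Cons y w)
    then have "w \<in> words X" "y \<in> Pos ` X \<union> Neg ` X" by (auto simp: words_def)
    then show ?case
      using Cons.IH h_push[of y "reduce w"] reduce_words[of w X] by (simp add: reduce_def h_def)
  qed (simp add: reduce_def)
  have "h \<in> hom (free_group X) H"
    by (rule homI) (auto simp: free_group_def h h_reduce h_append)
  moreover have "h [Pos x] = f x" if "x \<in> X" for x
    using that f by (auto simp: h_def e_def Pi_iff)
  ultimately show ?thesis by blast
qed


section \<open>Quasi-positive elements\<close>

definition conjugate :: "('g, 'b) monoid_scheme \<Rightarrow> 'g \<Rightarrow> 'g \<Rightarrow> 'g" where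
  "conjugate G a b = inv\<^bsub>G\<^esub> b \<otimes>\<^bsub>G\<^esub> a \<otimes>\<^bsub>G\<^esub> b"

definition list_product :: "('g, 'b) monoid_scheme \<Rightarrow> 'g list \<Rightarrow> 'g" where
  "list_product G gs = foldr (\<otimes>\<^bsub>G\<^esub>) gs \<one>\<^bsub>G\<^esub>"

text \<open>The empty list \<open>wcs\<close> yields the identity, which is quasi-positive by convention.\<close>

definition quasi_positive :: "'a set \<Rightarrow> 'a word \<Rightarrow> bool" where
  "quasi_positive X g \<longleftrightarrow>
     (\<exists>wcs. (\<forall>(w, c) \<in> set wcs. w \<in> positive_words X \<and> c \<in> carrier (free_group X)) \<and>
        g = list_product (free_group X)
              (map (\<lambda>(w, c). conjugate (free_group X) (reduce w) c) wcs))"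

definition quasi_positive_word :: "'a set \<Rightarrow> 'a word \<Rightarrow> bool" where
  "quasi_positive_word X w \<longleftrightarrow> quasi_positive X (reduce w)"


section \<open>TestQP\<close>

text \<open>In this section the letters of a word are numbered from 1:
  \<open>letter d k\<close> is $d_k$ and \<open>subword d a b\<close> is $d_a \cdots d_b$, which is empty if $b < a$.\<close>

definition letter :: "'a word \<Rightarrow> nat \<Rightarrow> 'a letter" where
  "letter d k = d ! (k - 1)"

definition subword :: "'a word \<Rightarrow> nat \<Rightarrow> nat \<Rightarrow> 'a word" where
  "subword d a b = take (Suc b - a) (drop (a - 1) d)"

definition first_negative :: "'a word \<Rightarrow> nat" where
  "first_negative w = Suc (length (takeWhile (\<lambda>y. \<not> negative y) w))"

definition left_subword :: "'a word \<Rightarrow> nat \<Rightarrow> 'a word" where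
  "left_subword w j = (let i = first_negative w in subword (w @ w) (i + 1) (i + j - 1))"

definition right_subword :: "'a word \<Rightarrow> nat \<Rightarrow> 'a word" where
  "right_subword w j =
     (let i = first_negative w in subword (w @ w) (i + j + 1) (length w + i - 1))"

definition inverse_pair :: "'a word \<Rightarrow> nat \<Rightarrow> bool" where
  "inverse_pair w j =
     (let i = first_negative w in letter (w @ w) (i + j) = inv_letter (letter w i))"

lemma length_left_subword: "j < length w \<Longrightarrow> length (left_subword w j) < length w"
  by (simp add: left_subword_def subword_def Let_def)

lemma length_right_subword: "j < length w \<Longrightarrow> length (right_subword w j) < length w"
  by (simp add: right_subword_def subword_def Let_def)

text \<open>\<open>test_qp_loop w j\<close> is the loop over \<open>j\<close>, entered at the value \<open>j\<close>.\<close>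

function test_qp :: "'a word \<Rightarrow> bool" and test_qp_loop :: "'a word \<Rightarrow> nat \<Rightarrow> bool" where
  "test_qp w = (if \<exists>y\<in>set w. negative y then test_qp_loop w 1 else True)"
| "test_qp_loop w j =
     (if j < length w then
        if inverse_pair w j \<and> test_qp (left_subword w j) \<and> test_qp (right_subword w j)
        then True else test_qp_loop w (j + 1)
      else False)"
  by pat_completeness auto
termination
  by (relation "inv_image (less_than <*lex*> less_than)
        (case_sum (\<lambda>w. (length w, length w + 1)) (\<lambda>(w, j). (length w, length w + 1 - j)))")
    (auto simp: length_left_subword length_right_subword dest: length_pos_if_in_set)

text \<open>In \<open>Node w x l r\<close> the labels of the vertex are the word \<open>w\<close> and the positive letter \<open>x\<close>.\<close>

datatype 'a qp_tree = Leaf "'a word" | Node "'a word" 'a "'a qp_tree" "'a qp_tree"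

function test_qp_tree :: "'a word \<Rightarrow> 'a qp_tree option"
  and test_qp_tree_loop :: "'a word \<Rightarrow> nat \<Rightarrow> 'a qp_tree option" where
  "test_qp_tree w = (if \<exists>y\<in>set w. negative y then test_qp_tree_loop w 1 else Some (Leaf w))"
| "test_qp_tree_loop w j =
     (if j < length w then
        if inverse_pair w j then
          case (test_qp_tree (left_subword w j), test_qp_tree (right_subword w j)) of
            (Some l, Some r) \<Rightarrow> Some (Node w (base (letter w (first_negative w))) l r)
          | _ \<Rightarrow> test_qp_tree_loop w (j + 1)
        else test_qp_tree_loop w (j + 1)
      else None)"
  by pat_completeness auto
termination
  by (relation "inv_image (less_than <*lex*> less_than)
        (case_sum (\<lambda>w. (length w, length w + 1)) (\<lambda>(w, j). (length w, length w + 1 - j)))")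
    (auto simp: length_left_subword length_right_subword dest: length_pos_if_in_set)

declare test_qp.simps [simp del] test_qp_loop.simps [simp del]
  test_qp_tree.simps [simp del] test_qp_tree_loop.simps [simp del]

lemma test_qp_iff_tree:
  "test_qp w \<longleftrightarrow> test_qp_tree w \<noteq> None"
  "test_qp_loop w j \<longleftrightarrow> test_qp_tree_loop w j \<noteq> None"
proof (induction w and w j rule: test_qp_test_qp_loop.induct)
  case (1 w)
  then show ?case by (subst test_qp.simps, subst test_qp_tree.simps) auto
next
  case (2 w j)
  then show ?case
    by (subst test_qp_loop.simps, subst test_qp_tree_loop.simps) (auto split: option.splits)
qed


section \<open>FactorQP\<close>

text \<open>The list \<open>[(x\<^sub>1, c\<^sub>1), \<dots>, (x\<^sub>k, c\<^sub>k)]\<close> encodes the expression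
  $x_1^{c_1} \cdots x_k^{c_k}$.\<close>

type_synonym 'a factorization = "('a \<times> 'a word) list"

definition is_factorization :: "'a set \<Rightarrow> 'a word \<Rightarrow> 'a factorization \<Rightarrow> bool" where
  "is_factorization X w f \<longleftrightarrow>
     (\<forall>(x, c) \<in> set f. x \<in> X \<and> c \<in> carrier (free_group X)) \<and>
     reduce w = list_product (free_group X)
                  (map (\<lambda>(x, c). conjugate (free_group X) [Pos x] c) f)"

definition conjugate_factorization ::
    "'a set \<Rightarrow> 'a factorization \<Rightarrow> 'a word \<Rightarrow> 'a factorization" where
  "conjugate_factorization X f d = map (\<lambda>(x, c). (x, c \<otimes>\<^bsub>free_group X\<^esub> d)) f"

function cyclic_reduction :: "'a word \<Rightarrow> 'a word" where
  "cyclic_reduction g =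
     (if g \<noteq> [] \<and> last g = inv_letter (hd g) then cyclic_reduction (butlast (tl g)) else g)"
  by pat_completeness auto
termination by (relation "measure length") auto

declare cyclic_reduction.simps [simp del]

datatype direction = LeftChild | RightChild

text \<open>The contents of a vertex during the execution of FactorQP: \<open>Unfactored w x\<close> is an inner vertex
  with its original labels, and \<open>Factored w f\<close> contains the word \<open>w\<close> expressed as the product \<open>f\<close>.\<close>

datatype 'a contents = Unfactored "'a word" 'a | Factored "'a word" "'a factorization"

text \<open>A state lists the remaining vertices in breadth-first order, so that the number of a vertex is
  its position in the list. A vertex is identified by the path leading to it from the root.\<close>

type_synonym 'a state = "(direction list \<times> 'a contents) list"

text \<open>The argument of \<open>bfs\<close> is the queue of the breadth-first traversal. The word of a leaf is turned
  into a product of its letters, each with the identity \<open>[]\<close> as exponent.\<close>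

function bfs :: "(direction list \<times> 'a qp_tree) list \<Rightarrow> 'a state" where
  "bfs [] = []"
| "bfs ((p, Leaf w) # q) = (p, Factored w (map (\<lambda>y. (base y, [])) w)) # bfs q"
| "bfs ((p, Node w x l r) # q) =
     (p, Unfactored w x) # bfs (q @ [(p @ [LeftChild], l), (p @ [RightChild], r)])"
  by pat_completeness auto
termination by (relation "measure (\<lambda>q. \<Sum>(p, t)\<leftarrow>q. Suc (2 * size t))") auto

definition initial_state :: "'a qp_tree \<Rightarrow> 'a state" where
  "initial_state T = bfs [([], T)]"

text \<open>One iteration of FactorQP, applied to the last two vertices. The equation for \<open>u\<close> does not
  determine \<open>u\<close> uniquely, so FactorQP is modelled as a nondeterministic procedure that may use any
  solution.\<close>

inductive factor_qp_step :: "'a set \<Rightarrow> 'a state \<Rightarrow> 'a state \<Rightarrow> bool" for X :: "'a set" where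
  "factor_qp_step X
     (s\<^sub>1 @ (p, Unfactored w x) # s\<^sub>2 @
       [(p @ [LeftChild], Factored w\<^sub>L f\<^sub>L), (p @ [RightChild], Factored w\<^sub>R f\<^sub>R)])
     (s\<^sub>1 @ (p, Factored w
             (conjugate_factorization X f\<^sub>L ([Pos x] \<otimes>\<^bsub>free_group X\<^esub> u \<otimes>\<^bsub>free_group X\<^esub> v) @
              conjugate_factorization X f\<^sub>R (u \<otimes>\<^bsub>free_group X\<^esub> v))) # s\<^sub>2)"
  if "v \<in> carrier (free_group X)"
    and "reduce w = conjugate (free_group X) (cyclic_reduction (reduce w)) v"
    and "2 * length v + length (cyclic_reduction (reduce w)) = length (reduce w)"
    and "u \<in> carrier (free_group X)"
    and "cyclic_reduction (reduce w) =
      conjugate (free_group X)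
        (conjugate (free_group X) (reduce w\<^sub>L) [Pos x] \<otimes>\<^bsub>free_group X\<^esub> reduce w\<^sub>R) u"

definition factor_qp_returns :: "'a set \<Rightarrow> 'a qp_tree \<Rightarrow> 'a factorization \<Rightarrow> bool" where
  "factor_qp_returns X T f \<longleftrightarrow>
     (\<exists>w. (factor_qp_step X)\<^sup>*\<^sup>* (initial_state T) [([], Factored w f)])"

text \<open>No run is infinite, and no run gets stuck before only the root remains.\<close>

definition factor_qp_always_returns :: "'a set \<Rightarrow> 'a qp_tree \<Rightarrow> bool" where
  "factor_qp_always_returns X T \<longleftrightarrow>
     (\<nexists>r. r 0 = initial_state T \<and> (\<forall>k. factor_qp_step X (r k) (r (Suc k)))) \<and>
     (\<forall>s. (factor_qp_step X)\<^sup>*\<^sup>* (initial_state T) s \<longrightarrow> (\<nexists>s'. factor_qp_step X s s') \<longrightarrow>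
       (\<exists>w f. s = [([], Factored w f)]))"

end

theory Submission
  imports Defs "HOL-Library.Sublist"
begin

text \<open>
  A word represents a quasi-positive element iff its negative letters can be matched, without
  crossings, with inverse positive letters, all unmatched letters being positive. A product of
  conjugates of positive words visibly has such a matching, and the existence of a matching is
  preserved by rotation and by inserting or deleting a pair of inverse letters, hence it only
  depends on the represented element. The partner of the first negative letter is a good pair: it
  cuts the cyclic word into two shorter words, each of which is matched.

  For FactorQP, the remaining vertices always form a tree whose breadth-first traversal is the
  current state, and the last two vertices of the traversal are factored siblings. The word $w$ of
  their parent is conjugate to $w_L^x w_R$, which provides $u$ and $v$.
\<close>

section \<open>Noncrossing matchings\<close>

text \<open>In \<open>Pair\<close> the letter \<open>a\<close> may have either sign, so a matched pair may also consist of a positive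
  letter followed by a negative one.\<close>

inductive matched :: "'a word \<Rightarrow> bool" where
  Nil: "matched []"
| Pos: "matched w \<Longrightarrow> matched (Pos x # w)"
| Pair: "matched u \<Longrightarrow> matched v \<Longrightarrow> matched (a # u @ inv_letter a # v)"

lemma matched_append: "matched u \<Longrightarrow> matched v \<Longrightarrow> matched (u @ v)"
  by (induction rule: matched.induct) (auto intro: matched.intros)

lemma matched_conj: "matched u \<Longrightarrow> matched (a # u @ [inv_letter a])"
  using Pair[OF _ Nil] .

lemma matched_single: "\<not> negative a \<Longrightarrow> matched [a]"
  by (cases a) (auto intro: matched.intros)

lemma matched_Cons_cases:
  assumes "matched (a # w)"
  obtains "\<not> negative a" "matched w"
  | p q where "w = p @ inv_letter a # q" "matched p" "matched q"
  using assms by cases auto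

text \<open>The rules build words from the left, so the fate of the last letter cannot be read off
  by inversion and needs an induction. It is either an unmatched positive letter or the right end of
  a pair.\<close>

lemma matched_snoc:
  "matched w \<Longrightarrow> w = w' @ [a] \<Longrightarrow>
    \<not> negative a \<and> matched w' \<or> (\<exists>p q. w' = p @ inv_letter a # q \<and> matched p \<and> matched q)"
proof (induction arbitrary: w' rule: matched.induct)
  case (Pos w x)
  show ?case
  proof (cases w')
    case Nil
    then show ?thesis using Pos by (auto intro: matched.intros)
  next
    case (Cons b w'')
    then have "b = letter.Pos x" "w = w'' @ [a]" using Pos.prems by auto
    with Pos.IH[of w''] Cons show ?thesis by (metis append_Cons matched.Pos)
  qed
next
  case (Pair u v b)
  show ?case
  proof (cases v rule: rev_cases)
    case Nil
    \<comment> \<open>With \<open>v\<close> empty the last letter closes the outermost pair, so its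
      partner is the head \<open>b\<close>, which equals \<open>inv_letter a\<close>.\<close>
    then have "w' = [] @ inv_letter a # u" using Pair.prems by auto
    then show ?thesis using Pair.hyps(1) matched.Nil by blast
  next
    case (snoc v' c)
    then have w': "w' = b # u @ inv_letter b # v'" and c: "v = v' @ [a]" using Pair.prems by auto
    from Pair.IH(2)[OF c] show ?thesis
    proof (elim disjE exE conjE)
      fix p q assume "v' = p @ inv_letter a # q" "matched p" "matched q"
      then have "w' = (b # u @ inv_letter b # p) @ inv_letter a # q"
        "matched (b # u @ inv_letter b # p)"
        using w' Pair.hyps(1) matched.Pair by auto
      then show ?thesis using \<open>matched q\<close> by blast
    qed (use w' Pair.hyps(1) matched.Pair in auto)
  qed
qed simp

lemma matched_snoc_cases:
  assumes "matched (w @ [a])"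
  obtains "\<not> negative a" "matched w"
  | p q where "w = p @ inv_letter a # q" "matched p" "matched q"
  using matched_snoc[OF assms refl] by blast

text \<open>Letters move to the end one at a time. If the moved letter \<open>a\<close> closes a
  pair with \<open>inv_letter a\<close> in front of \<open>q\<close>, that pair now encloses
  \<open>q\<close> and opens with the inverse letter; this is why \<open>Pair\<close> admits both
  sign orders.\<close>

lemma matched_rotate: "matched (u @ v) \<Longrightarrow> matched (v @ u)"
proof (induction u arbitrary: v)
  case (Cons a u)
  have "matched (u @ v @ [a])"
    using Cons.prems[simplified]
  proof (cases rule: matched_Cons_cases)
    case 1
    then show ?thesis
      using matched_append[OF _ matched_single, of "u @ v" a] by simp
  next
    case (2 p q)
    then show ?thesis
      using matched_append[OF 2(2) matched_conj[OF 2(3), of "inv_letter a"]]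
      by (metis append.assoc append_Cons inv_letter_inv_letter)
  qed
  then show ?case using Cons.IH[of "v @ [a]"] by simp
qed simp

text \<open>Rotation brings the gap to the front, where the new letters form a pair with empty
  interior.\<close>

lemma matched_insert:
  assumes "matched (u @ v)"
  shows "matched (u @ a # inv_letter a # v)"
  using matched_rotate[of "a # inv_letter a # v" u] Pair[OF Nil matched_rotate[OF assms], of a]
  by simp

text \<open>The case of deletion in which the cancelled \<open>inv_letter a\<close> closes the pair
  opened by the head \<open>a\<close>. The head takes over the role of the cancelled
  \<open>a\<close>: it is unmatched, or paired with the former partner of that letter.\<close>

lemma matched_delete_right:
  assumes "matched (u @ [a])" "matched v"
  shows "matched (a # u @ v)"
  using assms(1)
proof (cases rule: matched_snoc_cases)
  case 1
  then show ?thesis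
    using matched_append[OF matched_single matched_append[OF _ assms(2)], of a u] by simp
next
  case (2 p q)
  then show ?thesis using Pair[OF 2(2) matched_append[OF 2(3) assms(2)], of a] by simp
qed

text \<open>If the two cancelling letters have different partners, these partners are matched with each
  other; the partner of the negative one becomes unmatched if the positive one was.\<close>

lemma matched_delete:
  "matched w \<Longrightarrow> w = u @ a # inv_letter a # v \<Longrightarrow> matched (u @ v)"
proof (induction arbitrary: u v rule: matched.induct)
  case (Pos w x)
  show ?case
  proof (cases u)
    case Nil
    then have "matched (Neg x # v)" using Pos by auto
    then show ?thesis
      using Nil by (cases rule: matched_Cons_cases) (auto intro: matched.intros matched_append)
  next
    case (Cons b u')
    then show ?thesis using Pos by (auto intro: matched.intros)
  qed
next
  case (Pair w1 w2 b)
  show ?case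
  proof (cases u)
    case Nil
    then have b: "b = a" and eq: "w1 @ inv_letter a # w2 = inv_letter a # v"
      using Pair.prems by auto
    show ?thesis
    proof (cases w1)
      case Nil
      then show ?thesis using \<open>u = []\<close> eq Pair.hyps by simp
    next
      \<comment> \<open>The cancelled \<open>inv_letter a\<close> is the head of \<open>w1\<close>.
        The equal letter that closed the outer pair takes its place, unmatched or as the partner of
        the letter formerly paired with it.\<close>
      case (Cons c w1')
      then have "matched (inv_letter a # w1')" and v: "v = w1' @ inv_letter a # w2"
        using eq Pair.hyps by auto
      from this(1) have "matched v"
      proof (cases rule: matched_Cons_cases)
        case 1
        then show ?thesis
          using v matched_append[OF 1(2) matched_append[OF matched_single[OF 1(1)] Pair.hyps(2)]]
          by simp
      next
        case (2 p q)
        then show ?thesis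
          using v matched_append[OF 2(2) matched.Pair[OF 2(3) Pair.hyps(2), of a]] by simp
      qed
      then show ?thesis using \<open>u = []\<close> by simp
    qed
  next
    case (Cons c u')
    then have u: "u = b # u'" and eq: "w1 @ inv_letter b # w2 = u' @ a # inv_letter a # v"
      using Pair.prems by auto
    \<comment> \<open>The cancelling letters lie inside \<open>w1\<close>, or involve the closing
      letter \<open>inv_letter b\<close> as the second or as the first of the two, or lie inside
      \<open>w2\<close>.\<close>
    consider r where "w1 = u' @ a # inv_letter a # r" "v = r @ inv_letter b # w2"
      | "w1 = u' @ [a]" "b = a" "w2 = v"
      | "w1 = u'" "inv_letter b = a" "w2 = b # v"
      | r where "u' = w1 @ inv_letter b # r" "w2 = r @ a # inv_letter a # v"
    proof -
      consider us where "w1 = u' @ us" "us @ inv_letter b # w2 = a # inv_letter a # v"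
        | us where "u' = w1 @ us" "inv_letter b # w2 = us @ a # inv_letter a # v"
        using eq unfolding append_eq_append_conv2 by blast
      then show thesis
      proof cases
        case 1
        consider "us = []" | "us = [a]" | r where "us = a # inv_letter a # r"
          using 1(2) by (cases us; cases "tl us") auto
        then show thesis
        proof cases
          case 1
          with \<open>us @ inv_letter b # w2 = a # inv_letter a # v\<close>
          have "inv_letter b = a" "w2 = inv_letter a # v" by auto
          then show thesis using that(3) \<open>w1 = u' @ us\<close> 1 by auto
        next
          case 2
          then have "inv_letter b = inv_letter a" "w2 = v" using 1(2) by auto
          then show thesis using that(2) 1(1) 2 by (metis inv_letter_inv_letter)
        next
          case 3
          then show thesis using that(1) 1 by simp
        qed
      next
        case 2
        show thesis
        proof (cases us)
          case Nil
          then have "inv_letter b = a" "w2 = inv_letter a # v" using 2(2) by auto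
          then show thesis using that(3) 2(1) Nil by auto
        next
          case (Cons d r)
          then show thesis using that(4)[of r] 2 by simp
        qed
      qed
    qed
    then show ?thesis
    proof cases
      case 1
      then show ?thesis
        using matched.Pair[OF Pair.IH(1)[OF 1(1)] Pair.hyps(2)] u by simp
    next
      case 2
      then show ?thesis using matched_delete_right[of u' a v] Pair.hyps u by simp
    next
      case 3
      from Pair.hyps(2)[unfolded 3(3)] show ?thesis
      proof (cases rule: matched_Cons_cases)
        case 1
        then show ?thesis
          using 3 u matched_append[OF matched_single[OF 1(1)]
              matched_append[OF Pair.hyps(1) 1(2)]] by simp
      next
        case (2 p q)
        then show ?thesis
          using 3 u matched.Pair[OF matched_append[OF Pair.hyps(1) 2(2)] 2(3), of b] by simp
      qed
    next
      case 4
      then show ?thesis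
        using matched.Pair[OF Pair.hyps(1) Pair.IH(2)[OF 4(2)]] u by simp
    qed
  qed
qed simp

lemma matched_push: "matched (u @ push y v) \<longleftrightarrow> matched (u @ y # v)"
proof (cases "\<exists>z. v = inv_letter y # z")
  case True
  then obtain z where "v = inv_letter y # z" ..
  then show ?thesis
    using matched_insert[of u z y] matched_delete[of _ u y z] by (auto simp: push_def)
qed (auto simp: push_def split: list.splits)

lemma matched_reduce: "matched (reduce w) \<longleftrightarrow> matched w"
proof -
  \<comment> \<open>The prefix \<open>u\<close> holds the letters already passed, since each
    cancellation happens behind them.\<close>
  have "matched (u @ foldr push w []) \<longleftrightarrow> matched (u @ w)" for u
  proof (induction w arbitrary: u)
    case (Cons y w)
    then show ?case
      using Cons[of "u @ [y]"] by (simp add: matched_push)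
  qed simp
  from this[of "[]"] show ?thesis by (simp add: reduce_def)
qed


section \<open>Conjugates and factorizations\<close>

context group
begin

lemma conjugate_closed [simp, intro]:
  "a \<in> carrier G \<Longrightarrow> b \<in> carrier G \<Longrightarrow> conjugate G a b \<in> carrier G"
  by (simp add: conjugate_def)

lemma conjugate_mult:
  assumes "a \<in> carrier G" "b \<in> carrier G" "c \<in> carrier G"
  shows "conjugate G (a \<otimes> b) c = conjugate G a c \<otimes> conjugate G b c"
proof -
  have "c \<otimes> (inv c \<otimes> (b \<otimes> c)) = b \<otimes> c"
    using assms by (simp flip: m_assoc)
  then show ?thesis using assms by (simp add: conjugate_def m_assoc)
qed

lemma conjugate_conjugate:
  "a \<in> carrier G \<Longrightarrow> b \<in> carrier G \<Longrightarrow> c \<in> carrier G \<Longrightarrow>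
    conjugate G (conjugate G a b) c = conjugate G a (b \<otimes> c)"
  by (simp add: conjugate_def m_assoc inv_mult_group)

lemma conjugate_inv:
  "a \<in> carrier G \<Longrightarrow> b \<in> carrier G \<Longrightarrow> conjugate G (conjugate G a b) (inv b) = a"
  by (simp add: conjugate_conjugate) (simp add: conjugate_def)

lemma list_product_closed: "set gs \<subseteq> carrier G \<Longrightarrow> list_product G gs \<in> carrier G"
  by (induction gs) (auto simp: list_product_def)

lemma list_product_append:
  "set gs \<subseteq> carrier G \<Longrightarrow> set hs \<subseteq> carrier G \<Longrightarrow>
    list_product G (gs @ hs) = list_product G gs \<otimes> list_product G hs"
proof (induction gs)
  case Nil
  then show ?case using list_product_closed[of hs] by (simp add: list_product_def)
next
  case (Cons g gs)
  then show ?case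
    using list_product_closed[of hs] list_product_closed[of gs]
    by (simp add: list_product_def m_assoc)
qed

lemma list_product_conjugate:
  "set gs \<subseteq> carrier G \<Longrightarrow> c \<in> carrier G \<Longrightarrow>
    list_product G (map (\<lambda>g. conjugate G g c) gs) = conjugate G (list_product G gs) c"
proof (induction gs)
  case Nil
  then show ?case by (simp add: list_product_def conjugate_def)
next
  case (Cons g gs)
  then show ?case
    using list_product_closed[of gs] by (simp add: list_product_def conjugate_mult)
qed

end

section \<open>Words as elements of the free group\<close>

lemma letter_in_free_group [simp]: "x \<in> X \<Longrightarrow> [Pos x] \<in> carrier (free_group X)"
  by (auto simp: free_group_def words_def reduced_def)

lemma Nil_in_free_group [simp]: "[] \<in> carrier (free_group X)"
  by (auto simp: free_group_def words_def reduced_def)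

lemma reduced_Nil [simp]: "reduced []"
  by (simp add: reduced_def)

lemma reduced_single [simp]: "reduced [a]"
  by (simp add: reduced_def)

lemma conjugate_Nil: "g \<in> carrier (free_group X) \<Longrightarrow> conjugate (free_group X) g [] = g"
  using group.conjugate_inv[OF group_free_group, of g X "[]"]
    group.conjugate_conjugate[OF group_free_group, of g X "[]" "[]"]
  by (simp add: inv_free_group conjugate_def) (simp add: free_group_def inv_word_def)

text \<open>Turns conjugation in the group into concatenation of representatives, which need not be
  reduced, so that statements about matchings apply to conjugates.\<close>

lemma conjugate_reduce:
  assumes "g \<in> words X" "c \<in> words X"
  shows "conjugate (free_group X) (reduce g) (reduce c) = reduce (inv_word c @ g @ c)"
proof -
  have "inv\<^bsub>free_group X\<^esub> (reduce c) = reduce (inv_word c)"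
  proof (rule group.inv_equality[OF group_free_group])
    have "reduce (inv_word c) \<otimes>\<^bsub>free_group X\<^esub> reduce c = reduce (inv_word c @ c)"
      by (rule reduce_append_eq_mult[symmetric])
    then show "reduce (inv_word c) \<otimes>\<^bsub>free_group X\<^esub> reduce c = \<one>\<^bsub>free_group X\<^esub>"
      by (simp add: reduce_inv_word) (simp add: free_group_def)
  qed (use assms in \<open>auto simp: reduce_in_free_group inv_word_words\<close>)
  then show ?thesis
    by (simp add: conjugate_def flip: reduce_append_eq_mult)
qed

section \<open>Factorizations into conjugates of positive letters\<close>

lemma is_factorization_append:
  assumes "is_factorization X u f" "is_factorization X v g"
  shows "is_factorization X (u @ v) (f @ g)"
proof -
  interpret group "free_group X" by (rule group_free_group)
  show ?thesis
    using assms unfolding is_factorization_def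
    by (subst map_append, subst list_product_append)
      (auto simp: reduce_append_eq_mult[of u v X] intro!: conjugate_closed)
qed

text \<open>Conjugation by \<open>d\<close> distributes over the factors, and an iterated exponent
  becomes a product of exponents: this is the rewriting that FactorQP performs.\<close>

lemma is_factorization_conjugate:
  assumes f: "is_factorization X u f" and d: "d \<in> carrier (free_group X)"
    and w: "reduce w = conjugate (free_group X) (reduce u) d"
  shows "is_factorization X w (conjugate_factorization X f d)"
proof -
  interpret group "free_group X" by (rule group_free_group)
  have f': "x \<in> X" "c \<in> carrier (free_group X)" if "(x, c) \<in> set f" for x c
    using that f by (auto simp: is_factorization_def)
  let ?gs = "map (\<lambda>(x, c). conjugate (free_group X) [Pos x] c) f"
  have "map (\<lambda>(x, c). conjugate (free_group X) [Pos x] c) (conjugate_factorization X f d) =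
    map (\<lambda>g. conjugate (free_group X) g d) ?gs"
    using d f' by (auto simp: conjugate_factorization_def conjugate_conjugate)
  moreover have "list_product (free_group X) (map (\<lambda>g. conjugate (free_group X) g d) ?gs) =
      reduce w"
    using f d f' unfolding w is_factorization_def
    by (subst list_product_conjugate) auto
  ultimately have "reduce w = list_product (free_group X)
      (map (\<lambda>(x, c). conjugate (free_group X) [Pos x] c) (conjugate_factorization X f d))"
    by simp
  moreover have "\<forall>(x, c)\<in>set (conjugate_factorization X f d).
      x \<in> X \<and> c \<in> carrier (free_group X)"
    using d f' by (auto simp: conjugate_factorization_def)
  ultimately show ?thesis unfolding is_factorization_def by blast
qed

lemma is_factorization_letter: "x \<in> X \<Longrightarrow> is_factorization X [Pos x] [(x, [])]"
  using group.is_monoid[OF group_free_group, of X]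
  by (simp add: is_factorization_def list_product_def conjugate_Nil monoid.r_one)

lemma is_factorization_Nil: "is_factorization X [] []"
  by (simp add: is_factorization_def list_product_def free_group_def)

lemma is_factorization_positive:
  assumes "w \<in> words X" "\<forall>y\<in>set w. \<not> negative y"
  shows "is_factorization X w (map (\<lambda>y. (base y, [])) w)"
  using assms
proof (induction w)
  case (Cons y w)
  then obtain x where "y = Pos x" "x \<in> X" "w \<in> words X"
    by (auto simp: words_def)
  then show ?case
    using Cons is_factorization_append[OF is_factorization_letter, of x X w] by simp
qed (simp add: is_factorization_Nil)

section \<open>Quasi-positive words and matched words\<close>

lemma is_factorization_quasi_positive_word:
  assumes "is_factorization X w f"
  shows "quasi_positive_word X w"
  unfolding quasi_positive_word_def quasi_positive_def
  using assms
  by (intro exI[of _ "map (\<lambda>(x, c). ([Pos x], c)) f"])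
    (auto simp: is_factorization_def positive_words_def comp_def case_prod_unfold)

text \<open>The matching itself yields a factorization: an unmatched letter contributes itself, and
  a pair around \<open>u\<close> conjugates the factorization of \<open>u\<close> by
  \<open>inv_letter a\<close>.\<close>

lemma matched_quasi_positive_word:
  assumes "matched w" "w \<in> words X"
  shows "quasi_positive_word X w"
proof -
  have "\<exists>f. is_factorization X w f"
    using assms
  proof (induction rule: matched.induct)
    case Nil
    then show ?case using is_factorization_Nil by blast
  next
    case (Pos w x)
    then show ?case
      using is_factorization_append[OF is_factorization_letter, of x X w] by (auto simp: words_def)
  next
    case (Pair u v a)
    have d: "[inv_letter a] \<in> words X" and uv: "u \<in> words X" "v \<in> words X"
      using Pair.prems by (auto simp: words_def)
    obtain f g where fg: "is_factorization X u f" "is_factorization X v g"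
      using Pair.IH uv by blast
    have "is_factorization X (a # u @ [inv_letter a])
        (conjugate_factorization X f [inv_letter a])"
      using conjugate_reduce[OF uv(1) d] reduce_in_free_group[OF d]
      by (intro is_factorization_conjugate[OF fg(1)]) (auto simp: inv_word_def)
    from is_factorization_append[OF this fg(2)] show ?case by auto
  qed
  then show ?thesis using is_factorization_quasi_positive_word by blast
qed

text \<open>Each letter of \<open>c\<close> wraps one more pair around \<open>u\<close>. The head of
  \<open>c\<close> stands next to \<open>u\<close> and is absorbed first, so \<open>u\<close> varies
  in the induction.\<close>

lemma matched_conjugate: "matched u \<Longrightarrow> matched (inv_word c @ u @ c)"
proof (induction c arbitrary: u)
  case (Cons a c)
  have "matched (inv_letter a # u @ [a])"
    using matched_conj[OF Cons.prems, of "inv_letter a"] by simp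
  then show ?case using Cons.IH[of "inv_letter a # u @ [a]"] by (simp add: inv_word_def)
qed (simp add: inv_word_def)

lemma matched_positive: "\<forall>y\<in>set w. \<not> negative y \<Longrightarrow> matched w"
proof (induction w)
  case (Cons y w)
  then show ?case by (cases y) (auto intro: matched.intros)
qed (rule matched.Nil)

text \<open>Each conjugate has a matching before reduction, concatenation joins the matchings, and
  the reductions hidden in the group product are harmless by \<open>matched_reduce\<close>.\<close>

lemma quasi_positive_word_matched:
  assumes "quasi_positive_word X w"
  shows "matched w"
proof -
  obtain wcs where wcs: "\<forall>(w, c) \<in> set wcs. w \<in> positive_words X \<and> c \<in> carrier (free_group X)"
    and w: "reduce w = list_product (free_group X)
              (map (\<lambda>(w, c). conjugate (free_group X) (reduce w) c) wcs)"
    using assms by (auto simp: quasi_positive_word_def quasi_positive_def)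
  have "matched (list_product (free_group X)
              (map (\<lambda>(w, c). conjugate (free_group X) (reduce w) c) wcs))"
    using wcs
  proof (induction wcs)
    case Nil
    then show ?case by (simp add: list_product_def free_group_def matched.Nil)
  next
    case (Cons wc wcs)
    obtain u c where wc: "wc = (u, c)" by force
    have uc: "u \<in> words X" "\<forall>y\<in>set u. \<not> negative y" "c \<in> words X" "reduced c"
      using Cons.prems by (auto simp: wc words_def positive_words_def free_group_def)
    have "conjugate (free_group X) (reduce u) c = reduce (inv_word c @ u @ c)"
      using conjugate_reduce[OF uc(1,3)] uc(4) by simp
    moreover have "matched (inv_word c @ u @ c)"
      by (intro matched_conjugate matched_positive uc)
    ultimately have "matched (conjugate (free_group X) (reduce u) c)"
      by (simp add: matched_reduce)
    from matched_append[OF this Cons.IH] Cons.prems show ?case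
      by (simp add: wc list_product_def) (simp add: free_group_def matched_reduce)
  qed
  then show ?thesis using w matched_reduce by metis
qed


section \<open>Correctness of TestQP\<close>

lemma first_negative_split:
  assumes "\<exists>y\<in>set w. negative y"
  obtains u x v where "w = u @ Neg x # v" "first_negative w = Suc (length u)"
    "letter w (first_negative w) = Neg x"
proof -
  let ?u = "takeWhile (\<lambda>y. \<not> negative y) w"
  obtain a v where av: "dropWhile (\<lambda>y. \<not> negative y) w = a # v"
    using assms by (cases "dropWhile (\<lambda>y. \<not> negative y) w") (auto simp: dropWhile_eq_Nil_conv)
  then have "negative a" using hd_dropWhile[of "\<lambda>y. \<not> negative y" w] by auto
  then obtain x where "a = Neg x" by (cases a) auto
  then have w: "w = ?u @ Neg x # v" using av takeWhile_dropWhile_id by metis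
  have "w ! length ?u = Neg x" by (subst w) (simp only: nth_append_length)
  then show ?thesis by (intro that[OF w]) (auto simp: first_negative_def letter_def)
qed

text \<open>The letters $d_{i+1} \cdots d_{n+i-1}$ form the word \<open>r\<close>.\<close>

lemma subwords_rotation:
  assumes w: "w = u @ Neg x # v" and i: "first_negative w = Suc (length u)"
    and j: "1 \<le> j" "j < length w"
  defines "r \<equiv> v @ u"
  shows "left_subword w j = take (j - 1) r" "right_subword w j = drop j r"
    "inverse_pair w j \<longleftrightarrow> r ! (j - 1) = Pos x"
proof -
  have d: "w @ w = (u @ [Neg x]) @ r @ Neg x # v" by (simp add: w r_def)
  have len: "length w = Suc (length r)" by (simp add: w r_def)
  have "subword (w @ w) (Suc (length u) + 1) (Suc (length u) + j - 1) = take (j - 1) r"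
    unfolding d subword_def using j len by simp
  then show "left_subword w j = take (j - 1) r" by (simp add: left_subword_def i)
  \<comment> \<open>The right subword starts after \<open>u\<close>, the negative letter and
    \<open>j\<close> letters of \<open>r\<close>, the last of which is the candidate partner; it
    ends just before the second copy of \<open>Neg x\<close>.\<close>
  have "drop (length u + Suc j) (w @ w) = drop j r @ Neg x # v"
    unfolding d using j len by simp
  then have "subword (w @ w) (Suc (length u) + j + 1) (length w + Suc (length u) - 1) = drop j r"
    unfolding subword_def using j len by simp
  then show "right_subword w j = drop j r" by (simp add: right_subword_def i)
  have "(w @ w) ! (length (u @ [Neg x]) + (j - 1)) = r ! (j - 1)"
    unfolding d nth_append_length_plus using j len by (subst nth_append_left) auto
  then have "(w @ w) ! (length u + j) = r ! (j - 1)" using j by simp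
  moreover have "w ! length u = Neg x" by (simp add: w)
  ultimately show "inverse_pair w j \<longleftrightarrow> r ! (j - 1) = Pos x"
    by (simp add: inverse_pair_def i letter_def)
qed

text \<open>Rebuilds the cyclic word from the inputs of the two recursive calls; used both for
  soundness of the test and for the labels of the tree.\<close>

lemma good_pair_rotation:
  assumes "w = u @ Neg x # v" "first_negative w = Suc (length u)" "1 \<le> j" "j < length w"
    "inverse_pair w j"
  shows "v @ u = left_subword w j @ Pos x # right_subword w j"
  using subwords_rotation[OF assms(1-4)] assms(3-5) id_take_nth_drop[of "j - 1" "v @ u"]
  by (simp add: assms(1))

lemma test_qp_loop_iff:
  "test_qp_loop w j \<longleftrightarrow> (\<exists>k\<ge>j. k < length w \<and> inverse_pair w k \<and>
     test_qp (left_subword w k) \<and> test_qp (right_subword w k))"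
proof (induction "length w - j" arbitrary: j rule: less_induct)
  case less
  show ?case
  proof (cases "j < length w")
    case True
    then have IH: "test_qp_loop w (Suc j) \<longleftrightarrow> (\<exists>k\<ge>Suc j. k < length w \<and> inverse_pair w k \<and>
     test_qp (left_subword w k) \<and> test_qp (right_subword w k))"
      by (intro less) auto
    have split: "(\<exists>k\<ge>j. P k) \<longleftrightarrow> P j \<or> (\<exists>k\<ge>Suc j. P k)" for P
      by (metis Suc_leD le_refl not_less_eq_eq nle_le le_antisym)
    show ?thesis
      by (subst test_qp_loop.simps, subst split) (auto simp: True IH)
  next
    case False
    then show ?thesis by (subst test_qp_loop.simps) auto
  qed
qed

text \<open>After rotation the first negative letter is the head. Being negative it must have a
  partner, and the loop searches for exactly this partner; both subwords are shorter, so induction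
  on the length applies.\<close>

lemma test_qp_iff_matched: "test_qp w \<longleftrightarrow> matched w"
proof (induction "length w" arbitrary: w rule: less_induct)
  case less
  show ?case
  proof (cases "\<exists>y\<in>set w. negative y")
    case False
    then show ?thesis by (subst test_qp.simps) (auto simp: matched_positive)
  next
    case True
    then obtain u x v where w: "w = u @ Neg x # v" and i: "first_negative w = Suc (length u)"
      using first_negative_split by metis
    have rot: "matched w \<longleftrightarrow> matched (Neg x # v @ u)"
      using w matched_rotate[of u "Neg x # v"] matched_rotate[of "Neg x # v" u] by auto
    have IH: "test_qp (left_subword w k) \<longleftrightarrow> matched (left_subword w k)"
      "test_qp (right_subword w k) \<longleftrightarrow> matched (right_subword w k)" if "k < length w" for k
      using less that length_left_subword length_right_subword by blast+
    have "test_qp w \<longleftrightarrow> (\<exists>k\<ge>1. k < length w \<and> inverse_pair w k \<and>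
      matched (left_subword w k) \<and> matched (right_subword w k))"
      by (subst test_qp.simps) (use True IH in \<open>auto simp: test_qp_loop_iff\<close>)
    also have "\<dots> \<longleftrightarrow> matched (Neg x # v @ u)"
    proof
      assume "\<exists>k\<ge>1. k < length w \<and> inverse_pair w k \<and>
        matched (left_subword w k) \<and> matched (right_subword w k)"
      then show "matched (Neg x # v @ u)"
        using good_pair_rotation[OF w i] matched.Pair[of _ _ "Neg x"] by auto
    next
      assume "matched (Neg x # v @ u)"
      then show "\<exists>k\<ge>1. k < length w \<and> inverse_pair w k \<and>
        matched (left_subword w k) \<and> matched (right_subword w k)"
      proof (cases rule: matched_Cons_cases)
        \<comment> \<open>The partner sits directly behind \<open>p\<close>, so the loop meets it at
          the value \<open>Suc (length p)\<close>. The other case would leave \<open>Neg x\<close>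
          unmatched.\<close>
        case (2 p q)
        have "length (v @ u) = length (p @ inv_letter (Neg x) # q)" by (simp only: 2(1))
        then have len: "Suc (length p) < length w" by (simp add: w)
        have "left_subword w (Suc (length p)) = p" "right_subword w (Suc (length p)) = q"
          "inverse_pair w (Suc (length p))"
          using subwords_rotation[OF w i _ len] 2(1) by simp_all
        then show ?thesis using len 2 by (intro exI[of _ "Suc (length p)"]) auto
      qed simp
    qed
    finally show ?thesis using rot by simp
  qed
qed


section \<open>Cyclic reduction\<close>

lemma cyclic_reduction_split: "\<exists>v. g = inv_word v @ cyclic_reduction g @ v" if "reduced g"
  using that
proof (induction g rule: cyclic_reduction.induct)
  case (1 g)
  show ?case
  proof (cases "g \<noteq> [] \<and> last g = inv_letter (hd g)")
    case False
    then have "g = inv_word [] @ cyclic_reduction g @ []"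
      by (subst cyclic_reduction.simps) (auto simp: inv_word_def)
    then show ?thesis by blast
  next
    case True
    then obtain a h where "g = a # h" by (cases g) auto
    \<comment> \<open>\<open>h\<close> is not empty because a letter differs from its own
      inverse.\<close>
    moreover from this True obtain m where "h = m @ [inv_letter a]"
      by (cases h rule: rev_cases) (cases a; auto)+
    ultimately have g: "g = a # m @ [inv_letter a]" by simp
    then have "reduced m"
      using 1(2) by (auto simp: reduced_def successively_append_iff successively_Cons)
    with 1(1)[OF True] obtain v where "m = inv_word v @ cyclic_reduction m @ v"
      by (auto simp: g)
    then have "g = inv_word (v @ [inv_letter a]) @ cyclic_reduction g @ v @ [inv_letter a]"
      by (subst cyclic_reduction.simps) (simp add: g inv_word_def)
    then show ?thesis by blast
  qed
qed

text \<open>Supplies the \<open>v\<close> of FactorQP. The stripped letters form \<open>v\<close>,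
  and since the reduced word splits literally into three pieces, the lengths add up.\<close>

lemma cyclic_reduction_conjugate:
  assumes g: "g \<in> carrier (free_group X)"
  obtains v where "v \<in> carrier (free_group X)" "cyclic_reduction g \<in> carrier (free_group X)"
    "g = conjugate (free_group X) (cyclic_reduction g) v"
    "2 * length v + length (cyclic_reduction g) = length g"
proof -
  let ?c = "cyclic_reduction g"
  have red: "reduced g" "g \<in> words X" using g by (auto simp: free_group_def)
  then obtain v where v: "g = inv_word v @ ?c @ v" using cyclic_reduction_split by blast
  have w: "v \<in> words X" "?c \<in> words X" using red(2) v words_append by metis+
  have r: "reduced v" "reduced ?c"
    using red(1) v unfolding reduced_def by (metis successively_append_iff)+
  have "conjugate (free_group X) ?c v = reduce (inv_word v @ ?c @ v)"
    using conjugate_reduce[OF w(2,1)] r by simp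
  also have "\<dots> = g" using v red(1) by simp
  finally have "g = conjugate (free_group X) ?c v" ..
  moreover have "2 * length v + length ?c = length g"
    using arg_cong[OF v, of length] by (simp add: inv_word_def)
  ultimately show ?thesis using that w r by (auto simp: free_group_def)
qed

text \<open>The relation between the label of an inner vertex and the words of its children. Cyclic
  permutation is expressed by a cut, because \<open>a\<close> then serves as conjugator.\<close>

definition good_split :: "'a set \<Rightarrow> 'a word \<Rightarrow> 'a \<Rightarrow> 'a word \<Rightarrow> 'a word \<Rightarrow> bool" where
  "good_split X w x wl wr \<longleftrightarrow> w \<in> words X \<and>
     (\<exists>a b. w = a @ b \<and> b @ a = Neg x # wl @ Pos x # wr)"

lemma good_split_words:
  assumes "good_split X w x wl wr"
  shows "w \<in> words X" "x \<in> X" "wl \<in> words X" "wr \<in> words X"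
proof -
  obtain a b where ab: "w = a @ b" "b @ a = Neg x # wl @ Pos x # wr" and "w \<in> words X"
    using assms by (auto simp: good_split_def)
  then have "Neg x # wl @ Pos x # wr \<in> words X" by (metis words_append)
  then show "w \<in> words X" "x \<in> X" "wl \<in> words X" "wr \<in> words X"
    using \<open>w \<in> words X\<close> by (auto simp: words_def)
qed

text \<open>Conjugating \<open>w = a @ b\<close> by \<open>a\<close> gives \<open>b @ a\<close>,
  which represents \<open>wl^x wr\<close>. As \<open>w\<close> is also \<open>c^v\<close>, the
  inverse of \<open>v a\<close> is a solution \<open>u\<close>.\<close>

lemma good_split_conjugate:
  assumes "good_split X w x wl wr" and v: "v \<in> carrier (free_group X)"
    and c: "c \<in> carrier (free_group X)" and w: "reduce w = conjugate (free_group X) c v"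
  obtains u where "u \<in> carrier (free_group X)"
    "c = conjugate (free_group X)
      (conjugate (free_group X) (reduce wl) [Pos x] \<otimes>\<^bsub>free_group X\<^esub> reduce wr) u"
proof -
  interpret group "free_group X" by (rule group_free_group)
  note words = good_split_words[OF assms(1)]
  obtain a b where ab: "w = a @ b" "b @ a = Neg x # wl @ Pos x # wr"
    using assms(1) by (auto simp: good_split_def)
  have x: "[Pos x] \<in> words X" using words by (auto simp: words_def)
  have "conjugate (free_group X) (reduce w) (reduce a) = reduce (inv_word a @ w @ a)"
    using words(1) ab(1) by (intro conjugate_reduce) auto
  also have "\<dots> = reduce (reduce (inv_word a @ a) @ b @ a)"
    by (subst reduce_append_left) (simp add: ab(1))
  also have "\<dots> = reduce (b @ a)" by (simp add: reduce_inv_word)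
  also have "\<dots> = reduce ((inv_word [Pos x] @ wl @ [Pos x]) @ wr)"
    by (simp add: ab(2) inv_word_def)
  also have "\<dots> = conjugate (free_group X) (reduce wl) [Pos x] \<otimes>\<^bsub>free_group X\<^esub> reduce wr"
    (is "_ = ?g")
    using conjugate_reduce[OF words(3) x] by (subst reduce_append_eq_mult[of _ _ X]) simp
  finally have g: "?g = conjugate (free_group X) (conjugate (free_group X) c v) (reduce a)"
    using w by simp
  have a: "reduce a \<in> carrier (free_group X)"
    using words(1) ab(1) by (auto intro: reduce_in_free_group)
  have "c = conjugate (free_group X) ?g (inv\<^bsub>free_group X\<^esub> (v \<otimes>\<^bsub>free_group X\<^esub> reduce a))"
    unfolding g using c v a by (simp add: conjugate_conjugate[of _ v] conjugate_inv)
  then show ?thesis using that v a by blast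
qed


section \<open>Runs of FactorQP\<close>

text \<open>A state of FactorQP is represented by the tree of the remaining vertices.\<close>

datatype 'a run_tree = Done "'a word" "'a factorization"
  | Pending "'a word" 'a "'a run_tree" "'a run_tree"

fun root_word :: "'a run_tree \<Rightarrow> 'a word" where
  "root_word (Done w f) = w"
| "root_word (Pending w x l r) = w"

text \<open>The invariant of a run. Contraction keeps the word of a vertex, so
  \<open>root_word\<close> links a vertex to its children at any stage.\<close>

fun correct :: "'a set \<Rightarrow> 'a run_tree \<Rightarrow> bool" where
  "correct X (Done w f) \<longleftrightarrow> is_factorization X w f"
| "correct X (Pending w x l r) \<longleftrightarrow>
     correct X l \<and> correct X r \<and> good_split X w x (root_word l) (root_word r)"

fun initial_tree :: "'a qp_tree \<Rightarrow> 'a run_tree" where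
  "initial_tree (Leaf w) = Done w (map (\<lambda>y. (base y, [])) w)"
| "initial_tree (Node w x l r) = Pending w x (initial_tree l) (initial_tree r)"

text \<open>The traversal \<open>bfs\<close> carried over to partly contracted trees, so that later
  states are also traversals.\<close>

function bfs_run :: "(direction list \<times> 'a run_tree) list \<Rightarrow> 'a state" where
  "bfs_run [] = []"
| "bfs_run ((p, Done w f) # q) = (p, Factored w f) # bfs_run q"
| "bfs_run ((p, Pending w x l r) # q) =
     (p, Unfactored w x) # bfs_run (q @ [(p @ [LeftChild], l), (p @ [RightChild], r)])"
  by pat_completeness auto
termination by (relation "measure (\<lambda>q. \<Sum>(p, t)\<leftarrow>q. Suc (2 * size t))") auto

lemma bfs_eq_bfs_run: "bfs q = bfs_run (map (map_prod id initial_tree) q)"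
  by (induction q rule: bfs.induct) auto

lemma bfs_run_paths: "p \<in> fst ` set (bfs_run q) \<Longrightarrow> \<exists>p'\<in>fst ` set q. prefix p' p"
proof (induction q rule: bfs_run.induct)
  case (3 p' w x l r q)
  then show ?case by (force dest: append_prefixD)
qed force+

text \<open>Incomparable paths head disjoint subtrees, and this persists when the head of the queue
  is replaced by its children. Hence a path identifies one vertex of a state.\<close>

lemma bfs_run_distinct:
  "sorted_wrt parallel (map fst q) \<Longrightarrow> distinct (map fst (bfs_run q))"
proof (induction q rule: bfs_run.induct)
  case (2 p w f q)
  have "p \<notin> fst ` set (bfs_run q)"
    using bfs_run_paths[of p q] 2(2) by force
  then show ?case using 2 by simp
next
  case (3 p w x l r q)
  let ?q = "q @ [(p @ [LeftChild], l), (p @ [RightChild], r)]"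
  have "p' \<parallel> p @ [d]" if "(p', t) \<in> set q" for p' t d
  proof -
    have "p \<parallel> p'" using that 3(2) by force
    then show ?thesis
      using parallel_append[OF parallel_commute[THEN iffD1, OF \<open>p \<parallel> p'\<close>], of "[]" "[d]"]
      by simp
  qed
  then have "sorted_wrt parallel (map fst ?q)"
    using 3(2) by (force simp: sorted_wrt_append)
  then have "distinct (map fst (bfs_run ?q))" by (rule 3(1))
  moreover have "p \<notin> fst ` set (bfs_run ?q)"
    using bfs_run_paths[of p ?q] 3(2) by force
  ultimately show ?case by simp
qed simp

lemma bfs_run_all_done:
  "\<forall>(p, t)\<in>set q. \<exists>w f. t = Done w f \<Longrightarrow> bfs_run (q @ q') = bfs_run q @ bfs_run q'"
  by (induction q rule: bfs_run.induct) auto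

text \<open>The parent of the last two vertices may lie deep in the tree, so the contraction is stated for
  an arbitrary queue of the traversal, which makes it provable by induction along \<open>bfs_run\<close>.\<close>

lemma bfs_run_contract:
  assumes "\<exists>(p, t)\<in>set q. \<forall>w f. t \<noteq> Done w f" "\<forall>(p, t)\<in>set q. correct X t"
  shows "\<exists>s\<^sub>1 s\<^sub>2 p w x wl fl wr fr.
    bfs_run q = s\<^sub>1 @ (p, Unfactored w x) # s\<^sub>2 @
       [(p @ [LeftChild], Factored wl fl), (p @ [RightChild], Factored wr fr)] \<and>
    good_split X w x wl wr \<and> is_factorization X wl fl \<and> is_factorization X wr fr \<and>
    (\<forall>f. is_factorization X w f \<longrightarrow>
      (\<exists>q'. map (map_prod id root_word) q' = map (map_prod id root_word) q \<and>
        (\<forall>(p, t)\<in>set q'. correct X t) \<and> bfs_run q' = s\<^sub>1 @ (p, Factored w f) # s\<^sub>2))"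
  using assms
proof (induction q rule: bfs_run.induct)
  case (2 p\<^sub>0 w\<^sub>0 f\<^sub>0 q)
  have "\<exists>(p, t)\<in>set q. \<forall>w f. t \<noteq> Done w f" "\<forall>(p, t)\<in>set q. correct X t"
    using 2(2,3) by auto
  from 2(1)[OF this] obtain s\<^sub>1 s\<^sub>2 p w x wl fl wr fr where
    *: "bfs_run q = s\<^sub>1 @ (p, Unfactored w x) # s\<^sub>2 @
       [(p @ [LeftChild], Factored wl fl), (p @ [RightChild], Factored wr fr)]"
      "good_split X w x wl wr" "is_factorization X wl fl" "is_factorization X wr fr" and
    **: "is_factorization X w f \<Longrightarrow>
      (\<exists>q'. map (map_prod id root_word) q' = map (map_prod id root_word) q \<and>
        (\<forall>(p, t)\<in>set q'. correct X t) \<and> bfs_run q' = s\<^sub>1 @ (p, Factored w f) # s\<^sub>2)" for f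
    by blast
  have "\<exists>q'. map (map_prod id root_word) q' = map (map_prod id root_word) ((p\<^sub>0, Done w\<^sub>0 f\<^sub>0) # q) \<and>
        (\<forall>(p, t)\<in>set q'. correct X t) \<and>
        bfs_run q' = ((p\<^sub>0, Factored w\<^sub>0 f\<^sub>0) # s\<^sub>1) @ (p, Factored w f) # s\<^sub>2"
    if f: "is_factorization X w f" for f
  proof -
    obtain q' where "map (map_prod id root_word) q' = map (map_prod id root_word) q"
        "\<forall>(p, t)\<in>set q'. correct X t" "bfs_run q' = s\<^sub>1 @ (p, Factored w f) # s\<^sub>2"
      using **[OF f] by blast
    then show ?thesis using 2(3) by (intro exI[of _ "(p\<^sub>0, Done w\<^sub>0 f\<^sub>0) # q'"]) auto
  qed
  moreover have "bfs_run ((p\<^sub>0, Done w\<^sub>0 f\<^sub>0) # q) =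
      ((p\<^sub>0, Factored w\<^sub>0 f\<^sub>0) # s\<^sub>1) @ (p, Unfactored w x) # s\<^sub>2 @
       [(p @ [LeftChild], Factored wl fl), (p @ [RightChild], Factored wr fr)]"
    using *(1) by simp
  ultimately show ?case using *(2-4) by blast
next
  case (3 p\<^sub>0 w\<^sub>0 x\<^sub>0 l r q)
  let ?c = "[(p\<^sub>0 @ [LeftChild], l), (p\<^sub>0 @ [RightChild], r)]"
  have q: "\<forall>(p, t)\<in>set q. correct X t" and lr: "correct X l" "correct X r"
    and split: "good_split X w\<^sub>0 x\<^sub>0 (root_word l) (root_word r)"
    using 3(3) by auto
  show ?case
  \<comment> \<open>If some tree in the new queue is unfinished, the contraction happens there.
    Otherwise the head is the last unfactored vertex, and its children end the traversal.\<close>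
  proof (cases "\<exists>(p, t)\<in>set (q @ ?c). \<forall>w f. t \<noteq> Done w f")
    case True
    have "\<forall>(p, t)\<in>set (q @ ?c). correct X t" using q lr by auto
    from 3(1)[OF True this] obtain s\<^sub>1 s\<^sub>2 p w x wl fl wr fr where
      *: "bfs_run (q @ ?c) = s\<^sub>1 @ (p, Unfactored w x) # s\<^sub>2 @
         [(p @ [LeftChild], Factored wl fl), (p @ [RightChild], Factored wr fr)]"
        "good_split X w x wl wr" "is_factorization X wl fl" "is_factorization X wr fr" and
      **: "is_factorization X w f \<Longrightarrow>
        (\<exists>q'. map (map_prod id root_word) q' = map (map_prod id root_word) (q @ ?c) \<and>
          (\<forall>(p, t)\<in>set q'. correct X t) \<and> bfs_run q' = s\<^sub>1 @ (p, Factored w f) # s\<^sub>2)" for f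
      by blast
    have "\<exists>q'. map (map_prod id root_word) q' =
          map (map_prod id root_word) ((p\<^sub>0, Pending w\<^sub>0 x\<^sub>0 l r) # q) \<and>
          (\<forall>(p, t)\<in>set q'. correct X t) \<and>
          bfs_run q' = ((p\<^sub>0, Unfactored w\<^sub>0 x\<^sub>0) # s\<^sub>1) @ (p, Factored w f) # s\<^sub>2"
      if f: "is_factorization X w f" for f
    proof -
      obtain q' where q': "map (map_prod id root_word) q' = map (map_prod id root_word) (q @ ?c)"
          "\<forall>(p, t)\<in>set q'. correct X t" "bfs_run q' = s\<^sub>1 @ (p, Factored w f) # s\<^sub>2"
        using **[OF f] by blast
      \<comment> \<open>Paths and root words are unchanged, so the last two entries are still the
        children of the head and can be put back below it.\<close>
      from q'(1) obtain q'' l' r' where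
        q'': "q' = q'' @ [(p\<^sub>0 @ [LeftChild], l'), (p\<^sub>0 @ [RightChild], r')]"
          "map (map_prod id root_word) q'' = map (map_prod id root_word) q"
          "root_word l' = root_word l" "root_word r' = root_word r"
        by (auto simp: map_eq_append_conv map_eq_Cons_conv)
      then show ?thesis
        using q' split by (intro exI[of _ "(p\<^sub>0, Pending w\<^sub>0 x\<^sub>0 l' r') # q''"]) auto
    qed
    moreover have "bfs_run ((p\<^sub>0, Pending w\<^sub>0 x\<^sub>0 l r) # q) =
        ((p\<^sub>0, Unfactored w\<^sub>0 x\<^sub>0) # s\<^sub>1) @ (p, Unfactored w x) # s\<^sub>2 @
         [(p @ [LeftChild], Factored wl fl), (p @ [RightChild], Factored wr fr)]"
      using *(1) by simp
    ultimately show ?thesis using *(2-4) by blast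
  next
    case False
    then obtain wl fl wr fr where c: "l = Done wl fl" "r = Done wr fr"
      by fastforce
    have "bfs_run (q @ ?c) = bfs_run q @ bfs_run ?c"
      using False bfs_run_all_done[of q ?c] by fastforce
    then have "bfs_run ((p\<^sub>0, Pending w\<^sub>0 x\<^sub>0 l r) # q) =
       [] @ (p\<^sub>0, Unfactored w\<^sub>0 x\<^sub>0) # bfs_run q @
       [(p\<^sub>0 @ [LeftChild], Factored wl fl), (p\<^sub>0 @ [RightChild], Factored wr fr)]"
      by (simp add: c)
    moreover have "\<exists>q'. map (map_prod id root_word) q' =
          map (map_prod id root_word) ((p\<^sub>0, Pending w\<^sub>0 x\<^sub>0 l r) # q) \<and>
          (\<forall>(p, t)\<in>set q'. correct X t) \<and>
          bfs_run q' = [] @ (p\<^sub>0, Factored w\<^sub>0 f) # bfs_run q"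
      if "is_factorization X w\<^sub>0 f" for f
      using that q by (intro exI[of _ "(p\<^sub>0, Done w\<^sub>0 f) # q"]) auto
    ultimately show ?thesis using split lr c by (metis correct.simps(1) root_word.simps(1))
  qed
qed simp

section \<open>Single steps of FactorQP\<close>

lemma factor_qp_step_length: "factor_qp_step X s s' \<Longrightarrow> length s' < length s"
  by (induction rule: factor_qp_step.induct) simp

text \<open>Substituting \<open>c\<close> gives
  \<open>w = (wl^x wr)^(uv) = wl^(xuv) wr^(uv)\<close>, whichever solutions \<open>u\<close> and
  \<open>v\<close> were chosen.\<close>

lemma factor_qp_step_factorization:
  assumes "good_split X w x wl wr" and f: "is_factorization X wl fl" "is_factorization X wr fr"
    and v: "v \<in> carrier (free_group X)" and u: "u \<in> carrier (free_group X)"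
    and w: "reduce w = conjugate (free_group X) c v"
    and c: "c = conjugate (free_group X)
        (conjugate (free_group X) (reduce wl) [Pos x] \<otimes>\<^bsub>free_group X\<^esub> reduce wr) u"
  shows "is_factorization X w
    (conjugate_factorization X fl ([Pos x] \<otimes>\<^bsub>free_group X\<^esub> u \<otimes>\<^bsub>free_group X\<^esub> v) @
     conjugate_factorization X fr (u \<otimes>\<^bsub>free_group X\<^esub> v))"
proof -
  interpret group "free_group X" by (rule group_free_group)
  note words = good_split_words[OF assms(1)]
  have mem: "reduce wl \<in> carrier (free_group X)" "reduce wr \<in> carrier (free_group X)"
    "[Pos x] \<in> carrier (free_group X)"
    using words by (auto simp: reduce_in_free_group)
  let ?l = "conjugate (free_group X) (reduce wl) ([Pos x] \<otimes>\<^bsub>free_group X\<^esub> u \<otimes>\<^bsub>free_group X\<^esub> v)"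
  let ?r = "conjugate (free_group X) (reduce wr) (u \<otimes>\<^bsub>free_group X\<^esub> v)"
  have red: "reduced g" if "g \<in> carrier (free_group X)" for g
    using that by (simp add: free_group_def)
  have eq: "reduce w = ?l \<otimes>\<^bsub>free_group X\<^esub> ?r"
    unfolding w c using mem u v by (simp add: conjugate_mult conjugate_conjugate m_assoc)
  \<comment> \<open>The group elements \<open>?l\<close> and \<open>?r\<close> are reduced words, so
    they can themselves serve as the words being factored.\<close>
  have "is_factorization X ?l
      (conjugate_factorization X fl ([Pos x] \<otimes>\<^bsub>free_group X\<^esub> u \<otimes>\<^bsub>free_group X\<^esub> v))"
    using mem u v by (intro is_factorization_conjugate[OF f(1)] reduce_reduced red) auto
  moreover have "is_factorization X ?r (conjugate_factorization X fr (u \<otimes>\<^bsub>free_group X\<^esub> v))"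
    using mem u v by (intro is_factorization_conjugate[OF f(2)] reduce_reduced red) auto
  ultimately have "is_factorization X (?l @ ?r)
    (conjugate_factorization X fl ([Pos x] \<otimes>\<^bsub>free_group X\<^esub> u \<otimes>\<^bsub>free_group X\<^esub> v) @
     conjugate_factorization X fr (u \<otimes>\<^bsub>free_group X\<^esub> v))"
    by (rule is_factorization_append)
  then show ?thesis
    using eq unfolding is_factorization_def by (simp add: free_group_def)
qed

text \<open>Identifies the parent chosen by a step with the one found by contraction.\<close>

lemma distinct_fst_split:
  assumes "s\<^sub>1 @ (p, c) # s\<^sub>2 = t\<^sub>1 @ (p, d) # t\<^sub>2" "distinct (map fst (s\<^sub>1 @ (p, c) # s\<^sub>2))"
  shows "s\<^sub>1 = t\<^sub>1 \<and> c = d \<and> s\<^sub>2 = t\<^sub>2"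
proof -
  have "(p, d) \<in> set (s\<^sub>1 @ (p, c) # s\<^sub>2)" unfolding assms(1) by simp
  then have "c = d" using eq_key_imp_eq_value[OF assms(2), of p c d] by simp
  moreover have "distinct (map fst (t\<^sub>1 @ (p, d) # t\<^sub>2))" using assms by simp
  then have "(p, c) \<notin> set t\<^sub>1" "(p, c) \<notin> set t\<^sub>2" by force+
  ultimately show ?thesis using assms(1) append_Cons_eq_iff[of "(p, c)" t\<^sub>1 t\<^sub>2 s\<^sub>1 s\<^sub>2] by auto
qed

lemma factor_qp_step_correct:
  assumes step: "factor_qp_step X (bfs_run [([], t)]) s'" and t: "correct X t"
  obtains t' where "s' = bfs_run [([], t')]" "correct X t'" "root_word t' = root_word t"
proof -
  \<comment> \<open>A factored root alone gives a state with one vertex, whereas a step consumes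
    three.\<close>
  have ndone: "t \<noteq> Done w f" for w f
  proof
    assume "t = Done w f"
    with factor_qp_step.cases[OF step] show False by (auto simp: Cons_eq_append_conv)
  qed
  then have "\<exists>(p, t)\<in>set [([], t)]. \<forall>w f. t \<noteq> Done w f" by auto
  from bfs_run_contract[OF this, of X] t obtain s\<^sub>1 s\<^sub>2 p w x wl fl wr fr where
      s: "bfs_run [([], t)] = s\<^sub>1 @ (p, Unfactored w x) # s\<^sub>2 @
         [(p @ [LeftChild], Factored wl fl), (p @ [RightChild], Factored wr fr)]"
        and *: "good_split X w x wl wr" "is_factorization X wl fl" "is_factorization X wr fr" and
      **: "is_factorization X w f \<Longrightarrow>
        (\<exists>q'. map (map_prod id root_word) q' = map (map_prod id root_word) [([], t)] \<and>
          (\<forall>(p, t)\<in>set q'. correct X t) \<and> bfs_run q' = s\<^sub>1 @ (p, Factored w f) # s\<^sub>2)" for f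
    by auto
  have dist: "distinct (map fst (bfs_run [([], t)]))" by (rule bfs_run_distinct) simp
  from step show ?thesis
  proof cases
    case (1 v w' u wl' x' wr' t\<^sub>1 p' t\<^sub>2 fl' fr')
    \<comment> \<open>The last two entries fix the path of the parent; distinctness of paths then
      fixes its position and labels.\<close>
    have p: "p' = p" "wl' = wl" "fl' = fl" "wr' = wr" "fr' = fr"
      and eq: "s\<^sub>1 @ (p, Unfactored w x) # s\<^sub>2 = t\<^sub>1 @ (p, Unfactored w' x') # t\<^sub>2"
      using 1(1) s by auto
    have "distinct (map fst (s\<^sub>1 @ (p, Unfactored w x) # s\<^sub>2))"
      using dist unfolding s by auto
    from distinct_fst_split[OF eq this] have s12: "t\<^sub>1 = s\<^sub>1" "t\<^sub>2 = s\<^sub>2" "w' = w" "x' = x"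
      by auto
    note f = factor_qp_step_factorization[OF * 1(3,6) 1(4)[unfolded s12] 1(7)[unfolded p s12]]
    from **[OF f] obtain q' where
      q': "map (map_prod id root_word) q' = map (map_prod id root_word) [([], t)]"
        "\<forall>(p, t)\<in>set q'. correct X t" "bfs_run q' = s'"
      unfolding 1(2) p s12 by blast
    then show ?thesis using that by (auto simp: map_eq_Cons_conv)
  qed
qed

text \<open>An unfinished tree always admits a step: the factored siblings exist by contraction,
  \<open>v\<close> by cyclic reduction and \<open>u\<close> by the good split.\<close>

lemma factor_qp_progress:
  assumes t: "correct X t" and stuck: "\<nexists>s'. factor_qp_step X (bfs_run [([], t)]) s'"
  shows "\<exists>w f. t = Done w f"
proof (rule ccontr)
  assume "\<nexists>w f. t = Done w f"
  then have "\<exists>(p, t)\<in>set [([], t)]. \<forall>w f. t \<noteq> Done w f" by auto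
  from bfs_run_contract[OF this, of X] t obtain s\<^sub>1 s\<^sub>2 p w x wl fl wr fr where
      s: "bfs_run [([], t)] = s\<^sub>1 @ (p, Unfactored w x) # s\<^sub>2 @
         [(p @ [LeftChild], Factored wl fl), (p @ [RightChild], Factored wr fr)]"
        and split: "good_split X w x wl wr"
    by auto
  have "reduce w \<in> carrier (free_group X)"
    by (intro reduce_in_free_group good_split_words(1)[OF split])
  then obtain v where v: "v \<in> carrier (free_group X)"
    "cyclic_reduction (reduce w) \<in> carrier (free_group X)"
    "reduce w = conjugate (free_group X) (cyclic_reduction (reduce w)) v"
    "2 * length v + length (cyclic_reduction (reduce w)) = length (reduce w)"
    by (rule cyclic_reduction_conjugate)
  obtain u where "u \<in> carrier (free_group X)"
    "cyclic_reduction (reduce w) = conjugate (free_group X)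
      (conjugate (free_group X) (reduce wl) [Pos x] \<otimes>\<^bsub>free_group X\<^esub> reduce wr) u"
    by (rule good_split_conjugate[OF split v(1-3)])
  from factor_qp_step.intros[OF v(1,3,4) this] stuck show False unfolding s by blast
qed

text \<open>Establishes the invariant at the start of a run: every good pair found by the test is a
  good split.\<close>

lemma test_qp_tree_correct:
  "test_qp_tree w = Some T \<Longrightarrow> w \<in> words X \<Longrightarrow>
    correct X (initial_tree T) \<and> root_word (initial_tree T) = w"
  "test_qp_tree_loop w j = Some T \<Longrightarrow> w \<in> words X \<Longrightarrow> 1 \<le> j \<Longrightarrow> \<exists>y\<in>set w. negative y \<Longrightarrow>
    correct X (initial_tree T) \<and> root_word (initial_tree T) = w"
proof (induction w and w j arbitrary: T and T rule: test_qp_tree_test_qp_tree_loop.induct)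
  case (1 w)
  show ?case
  proof (cases "\<exists>y\<in>set w. negative y")
    case True
    then show ?thesis using 1 by (simp add: test_qp_tree.simps[of w])
  next
    case False
    then show ?thesis
      using 1 is_factorization_positive[of w X] by (auto simp: test_qp_tree.simps[of w])
  qed
next
  case (2 w j)
  have j: "j < length w"
    using 2(6) by (simp add: test_qp_tree_loop.simps[of w j] split: if_splits)
  obtain u x v where w: "w = u @ Neg x # v" and i: "first_negative w = Suc (length u)"
    and x: "letter w (first_negative w) = Neg x"
    using first_negative_split[OF 2(9)] .
  show ?case
  proof (cases "inverse_pair w j \<and> (\<exists>l r. test_qp_tree (left_subword w j) = Some l \<and>
      test_qp_tree (right_subword w j) = Some r)")
    case True
    then obtain l r where lr: "inverse_pair w j" "test_qp_tree (left_subword w j) = Some l"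
      "test_qp_tree (right_subword w j) = Some r" by blast
    then have T: "T = Node w x l r"
      using 2(6) j x by (simp add: test_qp_tree_loop.simps[of w j])
    have rot: "v @ u = left_subword w j @ Pos x # right_subword w j"
      using good_pair_rotation[OF w i 2(8) j lr(1)] .
    then have split: "good_split X w x (left_subword w j) (right_subword w j)"
      \<comment> \<open>The cut is made just before the first negative letter.\<close>
      unfolding good_split_def using w 2(7) by (intro conjI exI[of _ u] exI[of _ "Neg x # v"]) auto
    from 2(1)[OF j lr(1,2) good_split_words(3)[OF split]]
      2(2)[OF j lr(1,3) good_split_words(4)[OF split]] split
    show ?thesis by (simp add: T)
  next
    case False
    then have loop: "test_qp_tree_loop w (j + 1) = Some T"
      using 2(6) j by (auto simp: test_qp_tree_loop.simps[of w j] split: if_splits option.splits)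
    show ?thesis
    proof (cases "inverse_pair w j")
      case True
      have "correct X (initial_tree T) \<and> root_word (initial_tree T) = w"
      \<comment> \<open>Either recursive call may fail, and each failure continues the loop under
        its own induction hypothesis.\<close>
      proof (cases "test_qp_tree (left_subword w j)")
        case None
        then show ?thesis using 2(3)[OF j True refl None loop 2(7) _ 2(9)] by simp
      next
        case (Some l)
        then have "test_qp_tree (right_subword w j) = None"
          using False True by (cases "test_qp_tree (right_subword w j)") auto
        then show ?thesis using 2(4)[OF j True refl Some _ loop 2(7) _ 2(9)] by simp
      qed
      then show ?thesis .
    next
      case False
      then show ?thesis using 2(5)[OF j False loop 2(7) _ 2(9)] by simp
    qed
  qed
qed

section \<open>Correctness of TestQP, and termination and correctness of FactorQP\<close>

theorem theorem1:
  fixes X :: "'a set" and w :: "'a word"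
  assumes "w \<in> words X"
  shows "(test_qp w \<longleftrightarrow> quasi_positive_word X w) \<and>
    (quasi_positive_word X w \<longrightarrow>
      (\<exists>T. test_qp_tree w = Some T \<and>
           factor_qp_always_returns X T \<and>
           (\<forall>f. factor_qp_returns X T f \<longrightarrow> is_factorization X w f)))"
proof (intro conjI impI)
  show test: "test_qp w \<longleftrightarrow> quasi_positive_word X w"
    using test_qp_iff_matched matched_quasi_positive_word[OF _ assms] quasi_positive_word_matched
    by blast
  assume "quasi_positive_word X w"
  then obtain T where T: "test_qp_tree w = Some T" using test test_qp_iff_tree(1) by auto
  have inv: "\<exists>t. s = bfs_run [([], t)] \<and> correct X t \<and> root_word t = w"
    if "(factor_qp_step X)\<^sup>*\<^sup>* (initial_state T) s" for s
    using that
  proof induction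
    case base
    then show ?case
      using test_qp_tree_correct(1)[OF T assms] by (auto simp: initial_state_def bfs_eq_bfs_run)
  next
    case (step s s')
    then show ?case by (metis factor_qp_step_correct)
  qed
  have "\<nexists>r. r 0 = initial_state T \<and> (\<forall>k. factor_qp_step X (r k) (r (Suc k)))"
  proof
    assume "\<exists>r. r 0 = initial_state T \<and> (\<forall>k. factor_qp_step X (r k) (r (Suc k)))"
    then obtain r where "factor_qp_step X (r k) (r (Suc k))" for k by blast
    then have "length (r (Suc k)) < length (r k)" for k by (rule factor_qp_step_length)
    then show False
      using wf_iff_no_infinite_down_chain[THEN iffD1, OF wf_measure[of length]]
      by (metis in_measure)
  qed
  moreover have "\<exists>w f. s = [([], Factored w f)]"
    if "(factor_qp_step X)\<^sup>*\<^sup>* (initial_state T) s" "\<nexists>s'. factor_qp_step X s s'" for s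
    using inv[OF that(1)] that(2) factor_qp_progress by fastforce
  ultimately have "factor_qp_always_returns X T"
    unfolding factor_qp_always_returns_def by blast
  moreover have "is_factorization X w f" if returns: "factor_qp_returns X T f" for f
  proof -
    obtain w' where "(factor_qp_step X)\<^sup>*\<^sup>* (initial_state T) [([], Factored w' f)]"
      using returns by (auto simp: factor_qp_returns_def)
    from inv[OF this] obtain t where
      t: "[([], Factored w' f)] = bfs_run [([], t)]" "correct X t" "root_word t = w" by blast
    \<comment> \<open>A pending root would be listed as unfactored, so \<open>t\<close> is
      \<open>Done\<close> and its invariant is the claim.\<close>
    then show ?thesis by (cases t) auto
  qed
  ultimately show "\<exists>T. test_qp_tree w = Some T \<and> factor_qp_always_returns X T \<and>
      (\<forall>f. factor_qp_returns X T f \<longrightarrow> is_factorization X w f)"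
    using T by blast
qed

end
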